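(* Let $H$ be an infinite-dimensional separable complex Hilbert space and let $V\in\mathcal{B}(H)$ be a partial isometry. Then $V\in\mathcal{M}_r(H)$.
   Context: $\mathcal{B}(H)$ denotes the bounded linear operators on $H$. For a nonzero Hilbert space $M$ and $A\in\mathcal{B}(M)$, the minimum modulus is $m(A)=\inf\{\|Ax\|: x\in M,\ \|x\|=1\}$; $A$ is minimum attaining if there is a unit vector $x_0\in M$ with $\|Ax_0\|=m(A)$. A closed subspace $M\subseteq H$ reduces $T\in\mathcal{B}(H)$ if $T(M)\subseteq M$ and $T^*(M)\subseteq M$. $\mathcal{M}_r(H)$ is the set of all $T\in\mathcal{B}(H)$ such that for every nonzero closed subspace $M$ reducing $T$, the restriction $T|_M:M\to M$ is minimum attaining. *)

theory Defs
  imports "HOL-Analysis.Analysis"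
begin

text \<open>
  Complex inner product spaces, built over \<^class>\<open>real_normed_vector\<close>, so that norm, metric and
  topology are the library's. The axiom \<open>cinner_self\<close> makes the norm the one induced by the inner
  product, and with the norm axioms it yields positive definiteness. The inner product is linear
  in its first argument.
\<close>

class complex_inner = real_normed_vector +
  fixes scaleC :: "complex \<Rightarrow> 'a \<Rightarrow> 'a" (infixr "*\<^sub>C" 75)
    and cinner :: "'a \<Rightarrow> 'a \<Rightarrow> complex"
  assumes scaleC_add_right: "c *\<^sub>C (x + y) = c *\<^sub>C x + c *\<^sub>C y"
    and scaleC_add_left: "(c + d) *\<^sub>C x = c *\<^sub>C x + d *\<^sub>C x"
    and scaleC_scaleC: "c *\<^sub>C (d *\<^sub>C x) = (c * d) *\<^sub>C x"
    and scaleC_of_real: "complex_of_real r *\<^sub>C x = r *\<^sub>R x"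
    and cinner_commute: "cinner x y = cnj (cinner y x)"
    and cinner_add_left: "cinner (x + y) z = cinner x z + cinner y z"
    and cinner_scaleC_left: "cinner (c *\<^sub>C x) y = c * cinner x y"
    and cinner_self: "cinner x x = complex_of_real ((norm x)\<^sup>2)"

class chilbert_space = complex_inner + complete_space

global_interpretation complex_vector:
  vector_space "scaleC :: complex \<Rightarrow> 'a \<Rightarrow> 'a::complex_inner"
proof
  fix x :: 'a
  show "1 *\<^sub>C x = x"
    using scaleC_of_real[of 1 x] by simp
qed (simp_all add: scaleC_add_right scaleC_add_left scaleC_scaleC)

definition infinite_dimensional :: "'a::complex_inner itself \<Rightarrow> bool" where
  "infinite_dimensional _ \<longleftrightarrow>
     \<not> (\<exists>B::'a set. finite B \<and> complex_vector.span B = UNIV)"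

definition bounded_clinear :: "('a::complex_inner \<Rightarrow> 'b::complex_inner) \<Rightarrow> bool" where
  "bounded_clinear T \<longleftrightarrow>
     Vector_Spaces.linear scaleC scaleC T \<and> (\<exists>K. \<forall>x. norm (T x) \<le> norm x * K)"

text \<open>For bounded operators on a Hilbert space the adjoint exists and is unique (Riesz).\<close>

definition cadjoint :: "('a::chilbert_space \<Rightarrow> 'a) \<Rightarrow> 'a \<Rightarrow> 'a" where
  "cadjoint T = (THE S. bounded_clinear S \<and> (\<forall>x y. cinner (T x) y = cinner x (S y)))"

definition partial_isometry :: "('a::chilbert_space \<Rightarrow> 'a) \<Rightarrow> bool" where
  "partial_isometry V \<longleftrightarrow> bounded_clinear V \<and>
     (\<forall>x. (\<forall>z. V z = 0 \<longrightarrow> cinner x z = 0) \<longrightarrow> norm (V x) = norm x)"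

text \<open>
  The next two notions take the domain \<open>M\<close> explicitly: applied to \<open>M\<close> and \<open>T\<close> they speak about
  the restriction of \<open>T\<close> to \<open>M\<close>. They are meaningful for nonzero subspaces \<open>M\<close> only, since the
  infimum of the empty set of reals is unspecified.
\<close>

definition min_modulus :: "'a::complex_inner set \<Rightarrow> ('a \<Rightarrow> 'a) \<Rightarrow> real" where
  "min_modulus M A = Inf {norm (A x) |x. x \<in> M \<and> norm x = 1}"

definition minimum_attaining :: "'a::complex_inner set \<Rightarrow> ('a \<Rightarrow> 'a) \<Rightarrow> bool" where
  "minimum_attaining M A \<longleftrightarrow> (\<exists>x\<^sub>0\<in>M. norm x\<^sub>0 = 1 \<and> norm (A x\<^sub>0) = min_modulus M A)"

definition reduces :: "'a::chilbert_space set \<Rightarrow> ('a \<Rightarrow> 'a) \<Rightarrow> bool" where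
  "reduces M T \<longleftrightarrow> complex_vector.subspace M \<and> closed M \<and> T ` M \<subseteq> M \<and> cadjoint T ` M \<subseteq> M"

definition reducing_minimum_attaining :: "('a::chilbert_space \<Rightarrow> 'a) set" ("\<M>\<^sub>r") where
  "\<M>\<^sub>r = {T. bounded_clinear T \<and> (\<forall>M. reduces M T \<and> M \<noteq> {0} \<longrightarrow> minimum_attaining M T)}"

end

theory Submission
  imports Defs
begin

text \<open>
  Let \<open>M \<noteq> {0}\<close> reduce \<open>V\<close>. If \<open>V\<close> vanishes at some nonzero vector of \<open>M\<close>, the minimum modulus
  is \<open>0\<close> and is attained there. Otherwise \<open>M\<close> is orthogonal to the kernel of \<open>V\<close>: split \<open>z\<close> with
  \<open>V z = 0\<close> as \<open>p + w\<close>, where \<open>p \<in> M\<close> and \<open>w \<bottom> M\<close>; then \<open>V p = - V w\<close> lies in \<open>M\<close> and is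
  orthogonal to \<open>M\<close>, so \<open>V p = 0\<close>, hence \<open>p = 0\<close>. So \<open>V\<close> is isometric on \<open>M\<close> and every unit
  vector attains the minimum modulus \<open>1\<close>.
\<close>

section \<open>Complex inner products\<close>

lemma cinner_add_right: "cinner x (y + z) = cinner x y + cinner x z"
  by (metis cinner_add_left cinner_commute complex_cnj_add)

lemma cinner_scaleC_right: "cinner x (c *\<^sub>C y) = cnj c * cinner x y"
  by (metis cinner_scaleC_left cinner_commute complex_cnj_mult)

lemma cinner_zero_left [simp]: "cinner 0 x = 0"
  using cinner_add_left[of 0 0 x] by simp

lemma cinner_zero_right [simp]: "cinner x 0 = 0"
  using cinner_add_right[of x 0 0] by simp

lemma cinner_minus_left: "cinner (- x) y = - cinner x y"
  using cinner_add_left[of x "- x" y] by (simp add: add_eq_0_iff)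

lemma cinner_minus_right: "cinner x (- y) = - cinner x y"
  using cinner_add_right[of x y "- y"] by (simp add: add_eq_0_iff)

lemma cinner_diff_left: "cinner (x - y) z = cinner x z - cinner y z"
  using cinner_add_left[of x "- y" z] by (simp add: cinner_minus_left)

lemma cinner_diff_right: "cinner x (y - z) = cinner x y - cinner x z"
  using cinner_add_right[of x y "- z"] by (simp add: cinner_minus_right)

lemma power2_norm_eq_cinner: "(norm x)\<^sup>2 = Re (cinner x x)"
  by (simp add: cinner_self)

lemma cinner_eq_zero_iff [simp]: "cinner x x = 0 \<longleftrightarrow> x = 0"
  by (simp add: cinner_self)

text \<open>Pairing with \<open>z = x - y\<close> gives a vector of norm zero. This turns defining
  equations of the adjoint into equations between its values, for its linearity as well as its
  uniqueness.\<close>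

lemma cinner_right_ext:
  assumes "\<And>z. cinner z x = cinner z y"
  shows "x = y"
proof -
  have "cinner (x - y) (x - y) = 0"
    using assms by (simp add: cinner_diff_right)
  then show ?thesis by simp
qed

lemma parallelogram_law:
  fixes x y :: "'a::complex_inner"
  shows "(norm (x + y))\<^sup>2 + (norm (x - y))\<^sup>2 = 2 * (norm x)\<^sup>2 + 2 * (norm y)\<^sup>2"
  by (simp add: power2_norm_eq_cinner cinner_add_left cinner_add_right
      cinner_diff_left cinner_diff_right)

text \<open>Pythagoras: the subtracted vector is the orthogonal projection of \<open>x\<close> onto
  the line through \<open>y\<close>. Nonnegativity of the left side is Cauchy-Schwarz; applied to
  \<open>x - p\<close> for a nearest point \<open>p\<close>, it yields orthogonality.\<close>

lemma norm_diff_component: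
  fixes x y :: "'a::complex_inner"
  assumes "y \<noteq> 0"
  shows "(norm (x - (cinner x y / complex_of_real ((norm y)\<^sup>2)) *\<^sub>C y))\<^sup>2
    = (norm x)\<^sup>2 - (cmod (cinner x y))\<^sup>2 / (norm y)\<^sup>2"
proof -
  define s where "s = complex_of_real ((norm y)\<^sup>2)"
  define a where "a = cinner x y"
  have s: "s \<noteq> 0" "cnj s = s" "cinner y y = s"
    using assms by (simp_all add: s_def cinner_self)
  have yx: "cinner y x = cnj a"
    unfolding a_def by (rule cinner_commute)
  have "cinner (x - (a / s) *\<^sub>C y) (x - (a / s) *\<^sub>C y) = cinner x x - a * cnj a / s"
    using s by (simp add: cinner_diff_left cinner_diff_right cinner_scaleC_left
        cinner_scaleC_right yx a_def[symmetric] field_simps)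
  also have "\<dots> = complex_of_real ((norm x)\<^sup>2 - (cmod a)\<^sup>2 / (norm y)\<^sup>2)"
    by (simp add: cinner_self s_def complex_norm_square[symmetric])
  finally show ?thesis
    by (simp add: power2_norm_eq_cinner[of "x - _"] a_def s_def)
qed

lemma cauchy_schwarz_cinner: "cmod (cinner x y) \<le> norm x * norm y"
proof (cases "y = 0")
  case False
  have "0 \<le> (norm x)\<^sup>2 - (cmod (cinner x y))\<^sup>2 / (norm y)\<^sup>2"
    using norm_diff_component[OF False, of x] by (metis zero_le_power2)
  then have "(cmod (cinner x y))\<^sup>2 \<le> (norm x * norm y)\<^sup>2"
    using False by (simp add: power_mult_distrib divide_le_eq)
  then show ?thesis
    by (rule power2_le_imp_le) simp
qed simp

section \<open>Orthogonal projection and the adjoint\<close>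

lemma subspace_scaleR:
  assumes "complex_vector.subspace M" "x \<in> M"
  shows "r *\<^sub>R x \<in> M"
  using complex_vector.subspace_scale[OF assms, of "complex_of_real r"]
  by (simp add: scaleC_of_real)

text \<open>A minimizing sequence is Cauchy by the parallelogram law, so completeness gives a limit
  and closedness keeps it in \<open>M\<close>.\<close>

lemma nearest_point_exists:
  fixes x :: "'a::chilbert_space"
  assumes M: "complex_vector.subspace M" and "closed M"
  obtains p where "p \<in> M" "\<And>y. y \<in> M \<Longrightarrow> (norm (x - p))\<^sup>2 \<le> (norm (x - y))\<^sup>2"
proof -
  define d where "d = (INF y\<in>M. (norm (x - y))\<^sup>2)"
  have ne: "M \<noteq> {}"
    using complex_vector.subspace_0[OF M] by auto
  have bdd: "bdd_below ((\<lambda>y. (norm (x - y))\<^sup>2) ` M)"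
    by (rule bdd_belowI[of _ 0]) auto
  have d_le: "d \<le> (norm (x - y))\<^sup>2" if "y \<in> M" for y
    unfolding d_def using bdd that by (rule cINF_lower)
  have "\<exists>y\<in>M. (norm (x - y))\<^sup>2 < d + inverse (real (Suc n))" for n
    using cINF_less_iff[OF ne bdd, of "d + inverse (real (Suc n))"]
    by (simp add: d_def[symmetric])
  then obtain f where f: "\<And>n. f n \<in> M"
    and fd: "\<And>n. (norm (x - f n))\<^sup>2 < d + inverse (real (Suc n))"
    by metis
  have dist: "(norm (f m - f n))\<^sup>2 \<le> 2 * inverse (real (Suc m)) + 2 * inverse (real (Suc n))" for m n
  proof -
    \<comment> \<open>The midpoint lies in \<open>M\<close>, so its squared distance to
      \<open>x\<close> is at least \<open>d\<close>. In the parallelogram law this subtracts at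
      least \<open>4 * d\<close>, and only the two error terms survive.\<close>
    define y where "y = (1/2) *\<^sub>R (f m + f n)"
    have "y \<in> M"
      unfolding y_def by (intro subspace_scaleR complex_vector.subspace_add M f)
    moreover have "(x - f m) + (x - f n) = 2 *\<^sub>R (x - y)"
      by (simp add: y_def scaleR_2 algebra_simps)
    then have "(norm ((x - f m) + (x - f n)))\<^sup>2 = 4 * (norm (x - y))\<^sup>2"
      by (simp add: power_mult_distrib)
    moreover have "norm ((x - f m) - (x - f n)) = norm (f m - f n)"
      by (simp add: norm_minus_commute)
    ultimately show ?thesis
      using parallelogram_law[of "x - f m" "x - f n"] d_le[of y] fd[of m] fd[of n] by simp
  qed
  have "Cauchy f"
  proof (rule CauchyI)
    fix e :: real assume "e > 0"
    \<comment> \<open>For \<open>m\<close> and \<open>n\<close> beyond \<open>N\<close> the bound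
      \<open>dist\<close> is at most four times \<open>inverse (real (Suc N))\<close>.\<close>
    then have "0 < e\<^sup>2 / 4" by simp
    then obtain N where N: "inverse (real (Suc N)) < e\<^sup>2 / 4"
      using reals_Archimedean by blast
    have "norm (f m - f n) < e" if "m \<ge> N" "n \<ge> N" for m n
    proof -
      have "inverse (real (Suc m)) \<le> inverse (real (Suc N))"
        "inverse (real (Suc n)) \<le> inverse (real (Suc N))"
        using that by (auto intro!: le_imp_inverse_le)
      then have "(norm (f m - f n))\<^sup>2 < e\<^sup>2"
        using dist[of m n] N by linarith
      then show ?thesis
        by (rule power2_less_imp_less) (use \<open>e > 0\<close> in simp)
    qed
    then show "\<exists>N. \<forall>m\<ge>N. \<forall>n\<ge>N. norm (f m - f n) < e" by blast
  qed
  then obtain p where p: "f \<longlonglongrightarrow> p"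
    using Cauchy_convergent convergent_def by blast
  have "p \<in> M"
    using \<open>closed M\<close> f p by (rule closed_sequentially)
  moreover have "(norm (x - p))\<^sup>2 \<le> d"
  proof (rule LIMSEQ_le)
    show "(\<lambda>n. (norm (x - f n))\<^sup>2) \<longlonglongrightarrow> (norm (x - p))\<^sup>2"
      by (intro tendsto_intros p)
    show "(\<lambda>n. d + inverse (real (Suc n))) \<longlonglongrightarrow> d"
      by (rule LIMSEQ_inverse_real_of_nat_add)
  qed (use fd in \<open>auto intro: less_imp_le\<close>)
  ultimately show ?thesis
    using d_le that by (meson order_trans)
qed

text \<open>Take \<open>p\<close> nearest to \<open>x\<close>. If \<open>x - p\<close> had a nonzero
  component along some \<open>m\<close> in \<open>M\<close>, moving \<open>p\<close> by that
  component would bring it closer to \<open>x\<close>.\<close>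

lemma orthogonal_decomposition:
  fixes x :: "'a::chilbert_space"
  assumes M: "complex_vector.subspace M" and "closed M"
  obtains p w where "x = p + w" "p \<in> M" "\<And>m. m \<in> M \<Longrightarrow> cinner w m = 0"
proof -
  obtain p where p: "p \<in> M" and min: "\<And>y. y \<in> M \<Longrightarrow> (norm (x - p))\<^sup>2 \<le> (norm (x - y))\<^sup>2"
    using nearest_point_exists[OF assms] by blast
  have "cinner (x - p) m = 0" if "m \<in> M" for m
  proof (cases "m = 0")
    case False
    define c where "c = cinner (x - p) m / complex_of_real ((norm m)\<^sup>2)"
    have "p + c *\<^sub>C m \<in> M"
      by (intro complex_vector.subspace_add complex_vector.subspace_scale M p that)
    from min[OF this] have "(norm (x - p))\<^sup>2 \<le> (norm ((x - p) - c *\<^sub>C m))\<^sup>2"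
      by (simp add: diff_diff_eq)
    then have "(cmod (cinner (x - p) m))\<^sup>2 / (norm m)\<^sup>2 \<le> 0"
      using norm_diff_component[OF False, of "x - p", folded c_def] by linarith
    then show ?thesis
      using False by (simp add: divide_le_0_iff)
  qed simp
  then show ?thesis
    using that[of p "x - p"] p by simp
qed

text \<open>Unless \<open>f\<close> vanishes, its kernel is a proper closed subspace, and a multiple
  of any nonzero vector orthogonal to it represents \<open>f\<close>.\<close>

lemma riesz_representation:
  fixes f :: "'a::chilbert_space \<Rightarrow> complex"
  assumes f: "bounded_linear f" and hom: "\<And>c x. f (c *\<^sub>C x) = c * f x"
  obtains v where "\<And>x. f x = cinner x v"
proof (cases "\<forall>x. f x = 0")
  case True
  then show ?thesis using that[of 0] by simp
next
  case False
  then obtain u where u: "f u \<noteq> 0" by blast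
  interpret bounded_linear f by (rule f)
  define N where "N = {x. f x = 0}"
  have "complex_vector.subspace N"
    by (rule complex_vector.subspaceI) (auto simp: N_def zero add hom)
  moreover have "closed N"
    unfolding N_def by (intro closed_Collect_eq continuous_intros continuous_on)
  ultimately obtain p w where "u = p + w" and p: "p \<in> N"
    and w: "\<And>m. m \<in> N \<Longrightarrow> cinner w m = 0"
    using orthogonal_decomposition[of N u] by blast
  then have fw: "f w \<noteq> 0"
    using u by (simp add: N_def add)
  then have w0: "w \<noteq> 0"
    using zero by auto
  have "f x = cinner x ((cnj (f w) / cinner w w) *\<^sub>C w)" for x
  proof -
    \<comment> \<open>The combination is chosen so that \<open>f\<close> cancels on it; pairing it
      with \<open>w\<close> then determines \<open>f x\<close>.\<close>
    have "f w *\<^sub>C x - f x *\<^sub>C w \<in> N"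
      by (simp add: N_def diff hom)
    then have "cinner (f w *\<^sub>C x - f x *\<^sub>C w) w = 0"
      by (metis w cinner_commute complex_cnj_zero)
    then have "f w * cinner x w = f x * cinner w w"
      by (simp add: cinner_diff_left cinner_scaleC_left)
    moreover have "cnj (cinner w w) = cinner w w"
      by (rule cinner_commute[symmetric])
    ultimately show ?thesis
      using w0 by (simp add: cinner_scaleC_right field_simps)
  qed
  then show ?thesis by (rule that)
qed

lemma bounded_clinear_add: "bounded_clinear T \<Longrightarrow> T (x + y) = T x + T y"
  by (auto simp: bounded_clinear_def linear_iff_module_hom module_hom.add)

lemma bounded_clinear_scaleC: "bounded_clinear T \<Longrightarrow> T (c *\<^sub>C x) = c *\<^sub>C T x"
  by (auto simp: bounded_clinear_def linear_iff_module_hom module_hom.scale)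

lemma bounded_clinearI:
  assumes "\<And>x y. T (x + y) = T x + T y" "\<And>c x. T (c *\<^sub>C x) = c *\<^sub>C T x"
    and "\<And>x. norm (T x) \<le> norm x * K"
  shows "bounded_clinear T"
  unfolding bounded_clinear_def
proof
  show "Vector_Spaces.linear scaleC scaleC T"
    by unfold_locales (use assms in auto)
qed (use assms in blast)

text \<open>Riesz applied to \<open>cinner (T x) y\<close> as a functional of \<open>x\<close> gives
  \<open>S y\<close>, for each \<open>y\<close> separately. Any bound \<open>K\<close> for
  \<open>T\<close> also bounds \<open>S\<close>.\<close>

lemma cadjoint_exists:
  fixes T :: "'a::chilbert_space \<Rightarrow> 'a"
  assumes T: "bounded_clinear T"
  obtains S where "bounded_clinear S" "\<And>x y. cinner (T x) y = cinner x (S y)"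
proof -
  obtain K where K: "\<And>x. norm (T x) \<le> norm x * K"
    using T by (auto simp: bounded_clinear_def)
  have "\<exists>v. \<forall>x. cinner (T x) y = cinner x v" for y
  proof -
    have "bounded_linear (\<lambda>x. cinner (T x) y)"
    proof (rule bounded_linear_intro)
      fix x z :: 'a and r :: real
      show "cinner (T (x + z)) y = cinner (T x) y + cinner (T z) y"
        by (simp add: bounded_clinear_add[OF T] cinner_add_left)
      show "cinner (T (r *\<^sub>R x)) y = r *\<^sub>R cinner (T x) y"
        by (simp add: scaleC_of_real[symmetric] bounded_clinear_scaleC[OF T] cinner_scaleC_left
            scaleR_conv_of_real)
      have "cmod (cinner (T x) y) \<le> norm (T x) * norm y"
        by (rule cauchy_schwarz_cinner)
      also have "\<dots> \<le> norm x * K * norm y"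
        by (intro mult_right_mono K) simp
      finally show "cmod (cinner (T x) y) \<le> norm x * (K * norm y)"
        by (simp add: mult.assoc)
    qed
    moreover have "cinner (T (c *\<^sub>C x)) y = c * cinner (T x) y" for c x
      by (simp add: bounded_clinear_scaleC[OF T] cinner_scaleC_left)
    ultimately obtain v where "\<And>x. cinner (T x) y = cinner x v"
      using riesz_representation by blast
    then show ?thesis by blast
  qed
  then obtain S where S: "\<And>x y. cinner (T x) y = cinner x (S y)"
    by metis
  have "bounded_clinear S"
  proof (rule bounded_clinearI)
    show "S (y + z) = S y + S z" for y z
      by (rule cinner_right_ext) (simp add: S[symmetric] cinner_add_right)
    show "S (c *\<^sub>C y) = c *\<^sub>C S y" for c y
      by (rule cinner_right_ext) (simp add: S[symmetric] cinner_scaleC_right)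
    show "norm (S y) \<le> norm y * K" for y
    proof (cases "S y = 0")
      case True
      \<comment> \<open>The sign of \<open>K\<close> is not assumed; the bound on \<open>T\<close>
        at \<open>y\<close> itself supplies the inequality.\<close>
      have "0 \<le> norm y * K"
        using K[of y] norm_ge_zero order_trans by blast
      with True show ?thesis by simp
    next
      case False
      \<comment> \<open>The adjoint equation at \<open>x = S y\<close>; one factor
        \<open>norm (S y)\<close> is cancelled at the end.\<close>
      have "(norm (S y))\<^sup>2 = cmod (cinner (T (S y)) y)"
        by (simp add: S cinner_self norm_power)
      also have "\<dots> \<le> norm (T (S y)) * norm y"
        by (rule cauchy_schwarz_cinner)
      also have "\<dots> \<le> norm (S y) * K * norm y"
        by (intro mult_right_mono K) simp
      finally have "norm (S y) * norm (S y) \<le> norm (S y) * (norm y * K)"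
        by (simp add: power2_eq_square mult_ac)
      then show ?thesis
        using False by simp
    qed
  qed
  then show ?thesis
    using S that by blast
qed

text \<open>As \<open>cadjoint\<close> is a definite description, its equation becomes available
  only once existence and uniqueness are both known.\<close>

lemma cinner_cadjoint:
  fixes T :: "'a::chilbert_space \<Rightarrow> 'a"
  assumes "bounded_clinear T"
  shows "cinner (T x) y = cinner x (cadjoint T y)"
proof -
  let ?P = "\<lambda>S. bounded_clinear S \<and> (\<forall>x y. cinner (T x) y = cinner x (S y))"
  have "\<exists>!S. ?P S"
  proof (rule ex_ex1I)
    show "\<exists>S. ?P S"
      by (rule cadjoint_exists[OF assms]) blast
    fix S S' assume "?P S" "?P S'"
    then have "cinner x (S y) = cinner x (S' y)" for x y
      by presburger
    then show "S = S'"
      using cinner_right_ext by (intro ext) blast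
  qed
  from theI'[OF this] show ?thesis
    unfolding cadjoint_def by blast
qed

section \<open>Partial isometries\<close>

lemma reduces_orthogonal_kernel:
  fixes V :: "'a::chilbert_space \<Rightarrow> 'a"
  assumes V: "bounded_clinear V" and red: "reduces M V"
    and inj: "\<And>x. x \<in> M \<Longrightarrow> V x = 0 \<Longrightarrow> x = 0"
    and "x \<in> M" "V z = 0"
  shows "cinner x z = 0"
proof -
  have M: "complex_vector.subspace M" "closed M" "\<And>m. m \<in> M \<Longrightarrow> V m \<in> M"
    "\<And>m. m \<in> M \<Longrightarrow> cadjoint V m \<in> M"
    using red by (auto simp: reduces_def)
  obtain p w where z: "z = p + w" and p: "p \<in> M" and w: "\<And>m. m \<in> M \<Longrightarrow> cinner w m = 0"
    using orthogonal_decomposition[OF M(1,2), of z] by blast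
  have "V p = - V w"
    using \<open>V z = 0\<close> by (simp add: z bounded_clinear_add[OF V] add_eq_0_iff2)
  \<comment> \<open>Moving the left \<open>V\<close> across leaves \<open>w\<close> paired with
    \<open>cadjoint V (V p)\<close>, which is in \<open>M\<close> since \<open>M\<close> is
    invariant under both operators.\<close>
  moreover have "cinner (V w) (V p) = 0"
    by (simp add: cinner_cadjoint[OF V] w M p)
  ultimately have "cinner (V p) (V p) = 0"
    by (metis cinner_minus_left neg_equal_0_iff_equal)
  then have "p = 0"
    using inj p by simp
  then show ?thesis
    using w[OF \<open>x \<in> M\<close>] cinner_commute[of x z] by (simp add: z)
qed

lemma subspace_unit_multiple:
  assumes "complex_vector.subspace M" "x \<in> M" "x \<noteq> 0"
  shows "inverse (norm x) *\<^sub>R x \<in> M" "norm (inverse (norm x) *\<^sub>R x) = 1"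
  using assms by (simp_all add: subspace_scaleR)

lemma minimum_attainingI:
  assumes "x \<in> M" "norm x = 1" "\<And>y. y \<in> M \<Longrightarrow> norm y = 1 \<Longrightarrow> norm (A x) \<le> norm (A y)"
  shows "minimum_attaining M A"
proof -
  have "Inf {norm (A y) |y. y \<in> M \<and> norm y = 1} = norm (A x)"
    by (rule cInf_eq_minimum) (use assms in auto)
  then show ?thesis
    using assms by (auto simp: minimum_attaining_def min_modulus_def)
qed

theorem corollary3p16:
  fixes V :: "'a::chilbert_space \<Rightarrow> 'a"
  assumes "infinite_dimensional TYPE('a)"
    and "separable_space (euclidean :: 'a topology)"
    and "bounded_clinear V"
    and "partial_isometry V"
  shows "V \<in> \<M>\<^sub>r"
proof -
  have "minimum_attaining M V" if red: "reduces M V" and "M \<noteq> {0}" for M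
  proof (cases "\<exists>x\<in>M. x \<noteq> 0 \<and> V x = 0")
    have M: "complex_vector.subspace M"
      using red by (simp add: reduces_def)
    case True
    then obtain x where x: "x \<in> M" "x \<noteq> 0" "V x = 0" by blast
    have "V (inverse (norm x) *\<^sub>R x) = 0"
      by (simp add: scaleC_of_real[symmetric] bounded_clinear_scaleC[OF assms(3)] x(3)
          complex_vector.scale_zero_right del: of_real_inverse)
    then show ?thesis
      using subspace_unit_multiple[OF M x(1,2)] by (intro minimum_attainingI) auto
  next
    have M: "complex_vector.subspace M"
      using red by (simp add: reduces_def)
    case False
    \<comment> \<open>With \<open>V\<close> injective on \<open>M\<close>, vectors of
      \<open>M\<close> are orthogonal to the kernel, which is the premise of the isometry clause in
      \<open>partial_isometry\<close>.\<close>
    then have iso: "norm (V x) = norm x" if "x \<in> M" for x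
      using assms(4) reduces_orthogonal_kernel[OF assms(3) red] that
      unfolding partial_isometry_def by blast
    obtain x where x: "x \<in> M" "x \<noteq> 0"
      using \<open>M \<noteq> {0}\<close> complex_vector.subspace_0[OF M] by blast
    show ?thesis
      using subspace_unit_multiple[OF M x] iso by (intro minimum_attainingI) auto
  qed
  then show ?thesis
    using assms(3) by (simp add: reducing_minimum_attaining_def)
qed

end
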